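(* Assume A1*, A2, A3, A4 and B1 (stated in the context). Let $$\hat k_n=\min\ \underset{k\in[\bar k]}{\arg\min}\Big\{\min_{\psi_k\in\mathbb{S}_k}\ell_{k,n}(\psi_k)+\mathrm{pen}_{k,n}\Big\},\qquad \mathcal{K}^*=\underset{k\in[\bar k]}{\arg\min}\ L_k,\qquad L_k=\min_{\psi_k\in\mathbb{S}_k}\ell_k(\psi_k).$$ Then $\lim_{n\to\infty}\mathrm{P}(\hat k_n\in\mathcal{K}^* )=1$.
   Context: Setting. $(\Omega,\mathcal{A},\mathrm{P})$ is a probability space with expectation $\mathrm{E}$; $X:\Omega\to\mathbb{X}$ is a random map; $P$ denotes the law of $X$; $\mathfrak{m}$ is a measure on $(\mathbb{X},\mathcal{B}(\mathbb{X}))$. $\mathbb{T}\subset\mathbb{R}^m$ and $\phi:\mathbb{X}\times\mathbb{T}\to\mathbb{R}_{>0}$ satisfies $\int_{\mathbb{X}}\phi(x;\theta)\,\mathfrak{m}(\mathrm{d}x)=1$ for each $\theta\in\mathbb{T}$. Write $[k]=\{1,\dots,k\}$; $\bar k\in\mathbb{N}$ is fixed. For $k\in[\bar k]$ put $f_k(x;\psi_k)=\sum_{z=1}^k\pi_z\phi(x;\theta_z)$, where $\psi_k=(\pi_1,\dots,\pi_k,\theta_1,\dots,\theta_k)$ ranges over $\mathbb{S}_k=\{(\pi_1,\dots,\pi_k)\in[0,1]^k:\sum_z\pi_z=1\}\times\mathbb{T}^k$. Put $\ell_k(\psi_k)=-\mathrm{E}\{\log f_k(X;\psi_k)\}$ and,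 for a sample $X_1,\dots,X_n$, $\ell_{k,n}(\psi_k)=-n^{-1}\sum_{i=1}^n\log f_k(X_i;\psi_k)$. For each $k\in[\bar k]$ and $n$, $\mathrm{pen}_{k,n}$ is a real number (penalty). All random quantities of interest are assumed measurable. A1*: $X$ has density $f_0:\mathbb{X}\to\mathbb{R}_{>0}$ with respect to $\mathfrak{m}$ (not assumed to be a mixture of $\phi$-densities), and $X_1,\dots,X_n$ are IID replicates of $X$. A2: $\phi(x;\theta)>0$ for each $x\in\mathbb{X}$, $\theta\in\mathbb{T}$, and $\mathbb{T}\subset\mathbb{R}^m$ is compact. A3: $\phi(x;\cdot):\mathbb{T}\to\mathbb{R}$ is continuous for each fixed $x$, and $\phi(\cdot;\theta):\mathbb{X}\to\mathbb{R}$ is measurable for each fixed $\theta$. A4: there is $G_1\in\mathcal{L}_1(P)$ with $\max_{\theta\in\mathbb{T}}|\log\phi(x;\theta)|<G_1(x)$ for every $x\in\mathbb{X}$. B1: for each $k\in[\bar k]$, $\lim_{n\to\infty}\mathrm{pen}_{k,n}=0$. *)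

theory Defs
  imports "HOL-Probability.Probability"
begin

(* Least and Greatest are used rather than Inf and Sup: the value is a genuine minimum (maximum),
   attained on the set, and is unspecified if there is none. *)

definition min_over :: "'a set \<Rightarrow> ('a \<Rightarrow> real) \<Rightarrow> real" where
  "min_over A f = (LEAST v. v \<in> f ` A)"

definition max_over :: "'a set \<Rightarrow> ('a \<Rightarrow> real) \<Rightarrow> real" where
  "max_over A f = (GREATEST v. v \<in> f ` A)"

definition argmin_set :: "'a set \<Rightarrow> ('a \<Rightarrow> real) \<Rightarrow> 'a set" where
  "argmin_set A f = {a. is_arg_min f (\<lambda>x. x \<in> A) a}"

(* A parameter of the k-component mixture is a pair (p, t) of weights and component parameters,
   both indexed by {1..k}; being extensional, they carry no information outside {1..k}. *)

type_synonym 'p mixture_param = "(nat \<Rightarrow> real) \<times> (nat \<Rightarrow> 'p)"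

definition mixture_params :: "'p set \<Rightarrow> nat \<Rightarrow> 'p mixture_param set" where
  "mixture_params T k =
     {p \<in> {1..k} \<rightarrow>\<^sub>E {0..1}. (\<Sum>z = 1..k. p z) = 1} \<times> ({1..k} \<rightarrow>\<^sub>E T)"

definition mixture_density ::
    "('x \<Rightarrow> 'p \<Rightarrow> real) \<Rightarrow> nat \<Rightarrow> 'x \<Rightarrow> 'p mixture_param \<Rightarrow> real" where
  "mixture_density \<phi> k x \<psi> = (\<Sum>z = 1..k. fst \<psi> z * \<phi> x (snd \<psi> z))"

definition risk ::
    "'w measure \<Rightarrow> ('w \<Rightarrow> 'x) \<Rightarrow> ('x \<Rightarrow> 'p \<Rightarrow> real) \<Rightarrow> nat \<Rightarrow> 'p mixture_param \<Rightarrow> real" where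
  "risk M X \<phi> k \<psi> = - (\<integral>\<omega>. ln (mixture_density \<phi> k (X \<omega>) \<psi>) \<partial>M)"

(* The sample of size n consists of the first n entries x 1, ..., x n of the sequence x. *)

definition emp_risk ::
    "nat \<Rightarrow> (nat \<Rightarrow> 'x) \<Rightarrow> ('x \<Rightarrow> 'p \<Rightarrow> real) \<Rightarrow> nat \<Rightarrow> 'p mixture_param \<Rightarrow> real" where
  "emp_risk n x \<phi> k \<psi> = - (1 / real n) * (\<Sum>i = 1..n. ln (mixture_density \<phi> k (x i) \<psi>))"

definition order_estimate ::
    "'p set \<Rightarrow> ('x \<Rightarrow> 'p \<Rightarrow> real) \<Rightarrow> nat \<Rightarrow> (nat \<Rightarrow> nat \<Rightarrow> real) \<Rightarrow> nat \<Rightarrow> (nat \<Rightarrow> 'x) \<Rightarrow> nat" where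
  "order_estimate T \<phi> kbar pen n x =
     Min (argmin_set {1..kbar}
            (\<lambda>k. min_over (mixture_params T k) (emp_risk n x \<phi> k) + pen k n))"

definition optimal_orders ::
    "'w measure \<Rightarrow> ('w \<Rightarrow> 'x) \<Rightarrow> 'p set \<Rightarrow> ('x \<Rightarrow> 'p \<Rightarrow> real) \<Rightarrow> nat \<Rightarrow> nat set" where
  "optimal_orders M X T \<phi> kbar =
     argmin_set {1..kbar} (\<lambda>k. min_over (mixture_params T k) (risk M X \<phi> k))"

end

theory Submission
  imports Defs
begin

text \<open>
  The empirical minima of the losses converge in \<open>L\<^sup>1\<close> to the minima of the risks, and then
  Markov's inequality makes all of them, for \<open>k \<le> kbar\<close>, simultaneously closer to their limits
  than half the gap between the smallest and the second smallest value, with probability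
  tending to 1. The convergence is a uniform law of large numbers over a compact parameter
  space: the modulus of continuity at scale \<open>r\<close> of the loss in the parameter is a function of
  the observation that is dominated by twice the envelope and tends to 0 with \<open>r\<close>, so its
  expectation is small, and the law of large numbers is needed only for this modulus and for
  the finitely many parameters in an \<open>r\<close>-net. Working in \<open>L\<^sup>1\<close> keeps all error terms additive;
  the law of large numbers itself is proved there by truncation and a second moment bound.
\<close>

section \<open>The law of large numbers in the mean\<close>

text \<open>\<open>P\<close> is at once the measurable space of the observations and their common
  law. Indices start at 1, so that \<open>Xs 1, ..., Xs n\<close> is the sample of size
  \<open>n\<close>.\<close>

locale iid_sample = prob_space M for M :: "'w measure" +
  fixes P :: "'x measure" and Xs :: "nat \<Rightarrow> 'w \<Rightarrow> 'x"
  assumes indep: "indep_vars (\<lambda>_. P) Xs {1..}"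
    and distr_Xs: "\<And>i. i \<ge> 1 \<Longrightarrow> distr M P (Xs i) = P"
begin

text \<open>Averages are taken of functions of an observation, so that one law of large numbers
  covers losses and moduli of continuity alike. At \<open>n = 0\<close> the value is 0.\<close>

definition mean :: "nat \<Rightarrow> ('x \<Rightarrow> real) \<Rightarrow> 'w \<Rightarrow> real" where
  "mean n g \<omega> = (\<Sum>i = 1..n. g (Xs i \<omega>)) / real n"

lemma measurable_Xs: "i \<ge> 1 \<Longrightarrow> Xs i \<in> measurable M P"
  using indep by (auto simp: indep_vars_def)

lemma Xs_in_space: "i \<ge> 1 \<Longrightarrow> \<omega> \<in> space M \<Longrightarrow> Xs i \<omega> \<in> space P"
  using measurable_space[OF measurable_Xs] .

lemma prob_space_P: "prob_space P"
  using prob_space_distr[OF measurable_Xs[of 1]] distr_Xs[of 1] by simp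

section \<open>Sample means: expectation and L1 norm\<close>

lemma integrable_Xs:
  fixes g :: "'x \<Rightarrow> real"
  assumes "integrable P g" "i \<ge> 1"
  shows "integrable M (\<lambda>\<omega>. g (Xs i \<omega>))"
  using integrable_distr[OF measurable_Xs[of i], of g] distr_Xs[of i] assms by simp

lemma integral_Xs:
  fixes g :: "'x \<Rightarrow> real"
  assumes "g \<in> borel_measurable P" "i \<ge> 1"
  shows "(\<integral>\<omega>. g (Xs i \<omega>) \<partial>M) = (\<integral>x. g x \<partial>P)"
  using integral_distr[OF measurable_Xs[of i], of g] distr_Xs[of i] assms by simp

lemma integrable_mean:
  assumes "integrable P g"
  shows "integrable M (mean n g)"
  unfolding mean_def using assms
  by (intro integrable_divide_zero Bochner_Integration.integrable_sum integrable_Xs) auto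

lemma mean_mono:
  assumes "\<And>x. x \<in> space P \<Longrightarrow> f x \<le> g x" "\<omega> \<in> space M"
  shows "mean n f \<omega> \<le> mean n g \<omega>"
  unfolding mean_def using assms
  by (intro divide_right_mono sum_mono assms(1) Xs_in_space) auto

lemma mean_diff: "mean n (\<lambda>x. f x - g x) \<omega> = mean n f \<omega> - mean n g \<omega>"
  by (simp add: mean_def sum_subtractf diff_divide_distrib)

lemma abs_mean_le: "\<bar>mean n g \<omega>\<bar> \<le> mean n (\<lambda>x. \<bar>g x\<bar>) \<omega>"
  by (auto simp: mean_def intro!: divide_right_mono)

lemma integral_mean:
  assumes "integrable P g" "n \<ge> 1"
  shows "(\<integral>\<omega>. mean n g \<omega> \<partial>M) = (\<integral>x. g x \<partial>P)"
proof -
  have "(\<integral>\<omega>. mean n g \<omega> \<partial>M) = (\<Sum>i = 1..n. \<integral>\<omega>. g (Xs i \<omega>) \<partial>M) / real n"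
    unfolding mean_def using assms by (simp add: integrable_Xs)
  also have "(\<Sum>i = 1..n. \<integral>\<omega>. g (Xs i \<omega>) \<partial>M) = (\<Sum>i = 1..n. \<integral>x. g x \<partial>P)"
    using assms by (intro sum.cong refl integral_Xs) auto
  finally show ?thesis using assms by simp
qed

text \<open>Averaging is a contraction in L1, uniformly in \<open>n\<close>. This controls the
  remainder of a truncation, to which no second moment bound applies.\<close>

lemma integral_abs_mean_le:
  assumes "integrable P g" "n \<ge> 1"
  shows "(\<integral>\<omega>. \<bar>mean n g \<omega>\<bar> \<partial>M) \<le> (\<integral>x. \<bar>g x\<bar> \<partial>P)"
proof -
  have "(\<integral>\<omega>. \<bar>mean n g \<omega>\<bar> \<partial>M) \<le> (\<integral>\<omega>. mean n (\<lambda>x. \<bar>g x\<bar>) \<omega> \<partial>M)"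
    using assms by (intro integral_mono integrable_abs integrable_mean abs_mean_le) auto
  then show ?thesis using integral_mean[of "\<lambda>x. \<bar>g x\<bar>" n] assms by simp
qed

text \<open>Expand the square into products over pairs of indices. By independence and centering the
  off-diagonal ones have expectation 0; the \<open>n\<close> diagonal ones contribute at most
  \<open>c\<^sup>2\<close> each.\<close>

lemma integral_mean_square_le:
  assumes g[measurable]: "g \<in> borel_measurable P"
    and bound: "\<And>x. x \<in> space P \<Longrightarrow> \<bar>g x\<bar> \<le> c"
    and centered: "(\<integral>x. g x \<partial>P) = 0" and "n \<ge> 1"
  shows "integrable M (\<lambda>\<omega>. (mean n g \<omega>)\<^sup>2)" "(\<integral>\<omega>. (mean n g \<omega>)\<^sup>2 \<partial>M) \<le> c\<^sup>2 / n"
proof -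
  interpret P: prob_space P by (rule prob_space_P)
  have sq: "(g x)\<^sup>2 \<le> c\<^sup>2" if "x \<in> space P" for x
    using bound[OF that] by (intro abs_le_square_iff[THEN iffD1]) linarith
  have int_g: "integrable P g"
    using bound by (auto intro!: P.integrable_const_bound[of _ c] AE_I2)
  have int_g2: "integrable P (\<lambda>x. (g x)\<^sup>2)"
    using sq by (auto intro!: P.integrable_const_bound[of _ "c\<^sup>2"] AE_I2)
  \<comment> \<open>A single bound for both cases lets the inner sum over \<open>j\<close> collapse
    to \<open>c\<^sup>2\<close> below.\<close>
  have prod: "integrable M (\<lambda>\<omega>. g (Xs i \<omega>) * g (Xs j \<omega>)) \<and>
      (\<integral>\<omega>. g (Xs i \<omega>) * g (Xs j \<omega>) \<partial>M) \<le> (if i = j then c\<^sup>2 else 0)"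
    if ij: "i \<in> {1..n}" "j \<in> {1..n}" for i j
  proof (cases "i = j")
    case True
    have "(\<integral>x. (g x)\<^sup>2 \<partial>P) \<le> (\<integral>x. c\<^sup>2 \<partial>P)"
      using int_g2 sq by (intro integral_mono) auto
    then show ?thesis
      using True ij integrable_Xs[OF int_g2, of i] integral_Xs[of "\<lambda>x. (g x)\<^sup>2" i]
      by (simp add: power2_eq_square P.prob_space)
  next
    case False
    have ind: "indep_vars (\<lambda>_. borel) (\<lambda>i \<omega>. g (Xs i \<omega>)) {i, j}"
      using ij by (intro indep_vars_compose2[OF indep_vars_subset[OF indep]]) auto
    have int: "integrable M (\<lambda>\<omega>. g (Xs k \<omega>))" if "k \<in> {i, j}" for k
      using that ij by (intro integrable_Xs int_g) auto
    show ?thesis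
      using False ij indep_vars_lebesgue_integral[OF _ ind int] indep_vars_integrable[OF _ ind int]
      by (simp add: integral_Xs[OF g] centered)
  qed
  have eq: "(mean n g \<omega>)\<^sup>2 = (\<Sum>i = 1..n. \<Sum>j = 1..n. g (Xs i \<omega>) * g (Xs j \<omega>)) / (real n)\<^sup>2" for \<omega>
    by (simp add: mean_def power_divide power2_eq_square sum_product)
  show "integrable M (\<lambda>\<omega>. (mean n g \<omega>)\<^sup>2)"
    unfolding eq using prod
    by (intro integrable_divide_zero Bochner_Integration.integrable_sum) auto
  have "(\<integral>\<omega>. (mean n g \<omega>)\<^sup>2 \<partial>M) =
      (\<Sum>i = 1..n. \<Sum>j = 1..n. \<integral>\<omega>. g (Xs i \<omega>) * g (Xs j \<omega>) \<partial>M) / (real n)\<^sup>2"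
  proof -
    have "(\<integral>\<omega>. (\<Sum>i = 1..n. \<Sum>j = 1..n. g (Xs i \<omega>) * g (Xs j \<omega>)) \<partial>M) =
        (\<Sum>i = 1..n. \<integral>\<omega>. (\<Sum>j = 1..n. g (Xs i \<omega>) * g (Xs j \<omega>)) \<partial>M)"
      using prod by (intro Bochner_Integration.integral_sum Bochner_Integration.integrable_sum) auto
    also have "\<dots> = (\<Sum>i = 1..n. \<Sum>j = 1..n. \<integral>\<omega>. g (Xs i \<omega>) * g (Xs j \<omega>) \<partial>M)"
      using prod by (intro sum.cong refl Bochner_Integration.integral_sum) auto
    finally show ?thesis by (simp add: eq)
  qed
  also have "\<dots> \<le> (\<Sum>i = 1..n. \<Sum>j = 1..n. if i = j then c\<^sup>2 else 0) / (real n)\<^sup>2"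
    using prod by (intro divide_right_mono sum_mono) auto
  also have "\<dots> = c\<^sup>2 / n"
    using \<open>n \<ge> 1\<close> by (simp add: power2_eq_square)
  finally show "(\<integral>\<omega>. (mean n g \<omega>)\<^sup>2 \<partial>M) \<le> c\<^sup>2 / n" .
qed

text \<open>The first absolute moment is at most the square root of the second moment, which decays
  like \<open>1 / n\<close>.\<close>

lemma mean_tendsto_L1_bounded:
  assumes g[measurable]: "g \<in> borel_measurable P"
    and bound: "\<And>x. x \<in> space P \<Longrightarrow> \<bar>g x\<bar> \<le> c"
    and centered: "(\<integral>x. g x \<partial>P) = 0"
  shows "(\<lambda>n. \<integral>\<omega>. \<bar>mean n g \<omega>\<bar> \<partial>M) \<longlonglongrightarrow> 0"
proof (rule tendsto_sandwich[where f = \<open>\<lambda>_. 0\<close>])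
  interpret P: prob_space P by (rule prob_space_P)
  have int_g: "integrable P g"
    using bound by (auto intro!: P.integrable_const_bound[of _ c] AE_I2)
  show "(\<lambda>n. sqrt (c\<^sup>2 / real n)) \<longlonglongrightarrow> 0"
    using tendsto_real_sqrt[OF lim_const_over_n[of "c\<^sup>2"]] by simp
  show "eventually (\<lambda>n. (\<integral>\<omega>. \<bar>mean n g \<omega>\<bar> \<partial>M) \<le> sqrt (c\<^sup>2 / real n)) sequentially"
  proof (rule eventually_sequentiallyI[of 1], rule real_le_rsqrt)
    fix n :: nat assume n: "1 \<le> n"
    \<comment> \<open>The required case of Jensen's inequality is nonnegativity of the variance of
      the absolute mean.\<close>
    have "(\<integral>\<omega>. \<bar>mean n g \<omega>\<bar> \<partial>M)\<^sup>2 \<le> (\<integral>\<omega>. (mean n g \<omega>)\<^sup>2 \<partial>M)"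
      using variance_positive[of "\<lambda>\<omega>. \<bar>mean n g \<omega>\<bar>"] integral_mean_square_le(1)[OF assms n]
        integrable_mean[OF int_g, of n]
      by (subst (asm) variance_eq) auto
    also note integral_mean_square_le(2)[OF assms n]
    finally show "(\<integral>\<omega>. \<bar>mean n g \<omega>\<bar> \<partial>M)\<^sup>2 \<le> c\<^sup>2 / real n" .
  qed
qed (auto intro!: tendsto_const)

text \<open>Split \<open>g\<close> into a truncation, which is bounded and so has a second moment
  bound after centering, and a remainder that is small in L1. The level is fixed before
  \<open>n\<close> grows.\<close>

theorem mean_tendsto_L1:
  assumes g: "integrable P g"
  shows "(\<lambda>n. \<integral>\<omega>. \<bar>mean n g \<omega> - (\<integral>x. g x \<partial>P)\<bar> \<partial>M) \<longlonglongrightarrow> 0"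
proof (rule LIMSEQ_I)
  fix e :: real assume e: "e > 0"
  interpret P: prob_space P by (rule prob_space_P)
  note [measurable] = borel_measurable_integrable[OF g]
  \<comment> \<open>Beyond level \<open>m\<close> the truncation is 0, so \<open>g - t m\<close> is
    dominated by \<open>\<bar>g\<bar>\<close> and vanishes at each point once \<open>m\<close> is
    large.\<close>
  define t where "t m x = (if \<bar>g x\<bar> \<le> real m then g x else 0)" for m x
  have t_meas[measurable]: "t m \<in> borel_measurable P" for m
    unfolding t_def by measurable
  have "(\<lambda>m. \<integral>x. \<bar>g x - t m x\<bar> \<partial>P) \<longlonglongrightarrow> (\<integral>x. 0 \<partial>P)"
  proof (rule integral_dominated_convergence)
    show "integrable P (\<lambda>x. \<bar>g x\<bar>)" using g by simp
    show "AE x in P. (\<lambda>m. \<bar>g x - t m x\<bar>) \<longlonglongrightarrow> 0"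
    proof (rule AE_I2)
      fix x
      obtain N :: nat where "\<bar>g x\<bar> \<le> N" using real_arch_simple by blast
      then have "eventually (\<lambda>m. \<bar>g x - t m x\<bar> = 0) sequentially"
        by (intro eventually_sequentiallyI[of N]) (auto simp: t_def)
      then show "(\<lambda>m. \<bar>g x - t m x\<bar>) \<longlonglongrightarrow> 0"
        by (rule tendsto_eventually)
    qed
  qed (auto simp: t_def)
  then have "eventually (\<lambda>m. (\<integral>x. \<bar>g x - t m x\<bar> \<partial>P) < e / 3) sequentially"
    using e by (intro order_tendstoD(2)[of _ 0]) auto
  then obtain m where m: "(\<integral>x. \<bar>g x - t m x\<bar> \<partial>P) < e / 3"
    by (auto simp: eventually_sequentially)
  define \<mu> where "\<mu> = (\<integral>x. g x \<partial>P)"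
  \<comment> \<open>The truncation has to be centered by its own expectation; the distance from that
    to \<open>\<mu>\<close> is the third error term.\<close>
  define \<nu> where "\<nu> = (\<integral>x. t m x \<partial>P)"
  have int_t: "integrable P (t m)"
    by (auto intro!: P.integrable_const_bound[of _ m] simp: t_def)
  have mean_const: "mean n (\<lambda>x. k) \<omega> = k" if "n \<ge> 1" for n k \<omega>
    using that by (simp add: mean_def)
  have "(\<lambda>n. \<integral>\<omega>. \<bar>mean n (\<lambda>x. t m x - \<nu>) \<omega>\<bar> \<partial>M) \<longlonglongrightarrow> 0"
    by (rule mean_tendsto_L1_bounded[where c = "m + \<bar>\<nu>\<bar>"])
       (auto simp: t_def P.prob_space int_t[unfolded t_def] \<nu>_def[unfolded t_def])
  then have "eventually (\<lambda>n. (\<integral>\<omega>. \<bar>mean n (\<lambda>x. t m x - \<nu>) \<omega>\<bar> \<partial>M) < e / 3) sequentially"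
    using e by (intro order_tendstoD(2)[of _ 0]) auto
  then obtain N where N: "\<And>n. n \<ge> N \<Longrightarrow> (\<integral>\<omega>. \<bar>mean n (\<lambda>x. t m x - \<nu>) \<omega>\<bar> \<partial>M) < e / 3"
    by (auto simp: eventually_sequentially)
  have close: "\<bar>\<nu> - \<mu>\<bar> < e / 3"
    using m integral_abs_bound[of P "\<lambda>x. g x - t m x"] g int_t
    by (simp add: \<mu>_def \<nu>_def abs_minus_commute)
  \<comment> \<open>\<open>n \<ge> 1\<close> makes the mean of the constant \<open>\<nu>\<close>
    equal to \<open>\<nu>\<close>.\<close>
  have "norm ((\<integral>\<omega>. \<bar>mean n g \<omega> - \<mu>\<bar> \<partial>M) - 0) < e" if n: "n \<ge> max 1 N" for n
  proof -
    have 1: "integrable M (mean n (\<lambda>x. t m x - \<nu>))" "integrable M (mean n (\<lambda>x. g x - t m x))"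
      using int_t g by (auto intro!: integrable_mean)
    have "(\<integral>\<omega>. \<bar>mean n g \<omega> - \<mu>\<bar> \<partial>M) \<le>
        (\<integral>\<omega>. \<bar>mean n (\<lambda>x. t m x - \<nu>) \<omega>\<bar> + \<bar>mean n (\<lambda>x. g x - t m x) \<omega>\<bar> + \<bar>\<nu> - \<mu>\<bar> \<partial>M)"
      using 1 integrable_mean[OF g, of n] integrable_mean[OF int_t, of n] n
      by (intro integral_mono Bochner_Integration.integrable_add integrable_abs
          Bochner_Integration.integrable_diff integrable_const) (auto simp: mean_diff mean_const)
    also have "\<dots> = (\<integral>\<omega>. \<bar>mean n (\<lambda>x. t m x - \<nu>) \<omega>\<bar> \<partial>M) +
        (\<integral>\<omega>. \<bar>mean n (\<lambda>x. g x - t m x) \<omega>\<bar> \<partial>M) + \<bar>\<nu> - \<mu>\<bar>"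
      using 1 by (simp add: prob_space)
    also have "\<dots> < e / 3 + e / 3 + e / 3"
      using N[of n] n m close integral_abs_mean_le[of "\<lambda>x. g x - t m x" n] g int_t
      by (intro add_strict_mono) auto
    finally show ?thesis by simp
  qed
  then show "\<exists>N. \<forall>n\<ge>N. norm ((\<integral>\<omega>. \<bar>mean n g \<omega> - (\<integral>x. g x \<partial>P)\<bar> \<partial>M) - 0) < e"
    unfolding \<mu>_def by blast
qed

end

section \<open>Minima of continuous random functions\<close>

text \<open>Continuity in \<open>a\<close> makes the supremum over a countable dense subset of
  \<open>A\<close> equal to the one over \<open>A\<close>, and countable suprema are
  measurable.\<close>

lemma borel_measurable_SUP_continuous:
  fixes f :: "'a::{metric_space, second_countable_topology} \<Rightarrow> 'x \<Rightarrow> real"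
  assumes cont: "\<And>x. x \<in> space N \<Longrightarrow> continuous_on A (\<lambda>a. f a x)"
    and meas: "\<And>a. a \<in> A \<Longrightarrow> f a \<in> borel_measurable N"
    and bdd: "\<And>x. x \<in> space N \<Longrightarrow> bdd_above ((\<lambda>a. f a x) ` A)"
    and "A \<noteq> {}"
  shows "(\<lambda>x. SUP a\<in>A. f a x) \<in> borel_measurable N"
proof -
  obtain D where D: "countable D" "D \<subseteq> A" "A \<subseteq> closure D"
    using separable[of A] by blast
  have "D \<noteq> {}" using D \<open>A \<noteq> {}\<close> by auto
  have bddD: "bdd_above ((\<lambda>a. f a x) ` D)" if "x \<in> space N" for x
    using bdd[OF that] D(2) by (meson bdd_above_mono image_mono)
  have "(SUP a\<in>A. f a x) = (SUP a\<in>D. f a x)" if x: "x \<in> space N" for x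
  proof (rule antisym)
    show "(SUP a\<in>A. f a x) \<le> (SUP a\<in>D. f a x)"
    proof (rule cSUP_least[OF \<open>A \<noteq> {}\<close>])
      fix a assume a: "a \<in> A"
      then obtain s where s: "\<And>n. s n \<in> D" "s \<longlonglongrightarrow> a"
        using D(3) unfolding subset_eq closure_sequential by blast
      have "(\<lambda>n. f (s n) x) \<longlonglongrightarrow> f a x"
        using s D(2) by (intro continuous_on_tendsto_compose[OF cont[OF x]] a always_eventually) auto
      then show "f a x \<le> (SUP a\<in>D. f a x)"
        by (rule LIMSEQ_le_const2) (auto intro!: cSUP_upper bddD x s)
    qed
    show "(SUP a\<in>D. f a x) \<le> (SUP a\<in>A. f a x)"
      using D(2) \<open>D \<noteq> {}\<close> bdd[OF x] by (intro cSUP_subset_mono) auto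
  qed
  moreover have "(\<lambda>x. SUP a\<in>D. f a x) \<in> borel_measurable N"
    using D meas bddD by (intro borel_measurable_cSUP) auto
  ultimately show ?thesis
    by (subst measurable_cong[where g = "\<lambda>x. SUP a\<in>D. f a x"]) auto
qed

lemma min_over_eqI:
  assumes "a \<in> A" "\<And>b. b \<in> A \<Longrightarrow> f a \<le> f b"
  shows "min_over A f = f a"
  unfolding min_over_def using assms by (intro Least_equality) auto

text \<open>Being a \<open>LEAST\<close>, \<open>min_over\<close> carries information only where a
  minimum exists; compactness and continuity supply one.\<close>

lemma min_over_attained:
  assumes "compact K" "K \<noteq> {}" "continuous_on K f"
  obtains a where "a \<in> K" "min_over K f = f a" "\<And>b. b \<in> K \<Longrightarrow> f a \<le> f b"
proof -
  obtain a where a: "a \<in> K" "\<forall>b\<in>K. f a \<le> f b"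
    using continuous_attains_inf[OF assms] by blast
  with min_over_eqI[of a K f] show thesis by (intro that) auto
qed

text \<open>This carries measurability of suprema over to \<open>min_over\<close>.\<close>

lemma min_over_eq_SUP:
  assumes "compact K" "K \<noteq> {}" "continuous_on K f"
  shows "min_over K f = - (SUP a\<in>K. - f a)"
proof -
  obtain a where "a \<in> K" "min_over K f = f a" "\<And>b. b \<in> K \<Longrightarrow> f a \<le> f b"
    using min_over_attained[OF assms] by blast
  moreover from this have "(SUP a\<in>K. - f a) = - f a"
    by (intro cSup_eq_maximum) auto
  ultimately show ?thesis by simp
qed

text \<open>Evaluate each function at the minimizer of the other: minimization is 1-Lipschitz in the
  uniform distance.\<close>

lemma abs_min_over_diff_le:
  assumes K: "compact K" "K \<noteq> {}" and f: "continuous_on K f" and g: "continuous_on K g"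
    and le: "\<And>a. a \<in> K \<Longrightarrow> \<bar>f a - g a\<bar> \<le> d"
  shows "\<bar>min_over K f - min_over K g\<bar> \<le> d"
proof -
  obtain a where a: "a \<in> K" "min_over K f = f a" "\<And>b. b \<in> K \<Longrightarrow> f a \<le> f b"
    using min_over_attained[OF K f] by blast
  obtain b where b: "b \<in> K" "min_over K g = g b" "\<And>c. c \<in> K \<Longrightarrow> g b \<le> g c"
    using min_over_attained[OF K g] by blast
  show ?thesis
    using a(3)[OF b(1)] b(3)[OF a(1)] le[OF a(1)] le[OF b(1)] unfolding a(2) b(2) by linarith
qed

section \<open>Uniform convergence over a compact parameter space\<close>

text \<open>The uniform law of large numbers is kept free of the form of the loss. For mixtures,
  \<open>K\<close> becomes the parameter set of one order and \<open>H\<close> the envelope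
  \<open>G1\<close>.\<close>

locale compact_loss = iid_sample M P Xs
  for M :: "'w measure" and P :: "'x measure" and Xs :: "nat \<Rightarrow> 'w \<Rightarrow> 'x" +
  fixes K :: "'a::{metric_space, second_countable_topology} set"
    and h :: "'a \<Rightarrow> 'x \<Rightarrow> real" and H :: "'x \<Rightarrow> real"
  assumes compact_K: "compact K" and K_nonempty: "K \<noteq> {}"
    and loss_continuous: "\<And>x. x \<in> space P \<Longrightarrow> continuous_on K (\<lambda>a. h a x)"
    and loss_measurable: "\<And>a. a \<in> K \<Longrightarrow> h a \<in> borel_measurable P"
    and envelope: "\<And>a x. a \<in> K \<Longrightarrow> x \<in> space P \<Longrightarrow> \<bar>h a x\<bar> \<le> H x"
    and integrable_envelope: "integrable P H"
begin

lemma integrable_loss: "a \<in> K \<Longrightarrow> integrable P (h a)"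
  using envelope by (intro Bochner_Integration.integrable_bound[OF integrable_envelope])
    (auto intro!: loss_measurable AE_I2 order.trans[OF _ abs_ge_self])

text \<open>Compactness gives uniform continuity separately for each \<open>x\<close>; integrating
  over \<open>x\<close> yields one radius \<open>r\<close> at which the modulus is small on
  average.\<close>

lemma modulus_of_continuity:
  assumes e: "e > 0"
  obtains r w where "r > 0" "integrable P w" "(\<integral>x. w x \<partial>P) < e"
    "\<And>x a b. x \<in> space P \<Longrightarrow> a \<in> K \<Longrightarrow> b \<in> K \<Longrightarrow> dist a b < r \<Longrightarrow> \<bar>h a x - h b x\<bar> \<le> w x"
proof -
  \<comment> \<open>The scales \<open>1 / (n + 1)\<close> form a sequence, as dominated convergence
    requires.\<close>
  define S where "S n = {p \<in> K \<times> K. dist (fst p) (snd p) < 1 / real (Suc n)}" for n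
  define D where "D p x = \<bar>h (fst p) x - h (snd p) x\<bar>" for p x
  define w where "w n x = (SUP p\<in>S n. D p x)" for n x
  note H_meas[measurable] = borel_measurable_integrable[OF integrable_envelope]
  \<comment> \<open>Every \<open>S n\<close> contains the diagonal; nonemptiness is what makes the
    supremum \<open>w n x\<close> meaningful and nonnegative.\<close>
  have S_ne: "S n \<noteq> {}" for n
  proof -
    obtain a where "a \<in> K" using K_nonempty by blast
    then have "(a, a) \<in> S n" by (simp add: S_def)
    then show ?thesis by blast
  qed
  have D_le: "D p x \<le> 2 * H x" if "p \<in> S n" "x \<in> space P" for p n x
    using that envelope[of "fst p" x] envelope[of "snd p" x] by (auto simp: S_def D_def)
  have D_bdd: "bdd_above ((\<lambda>p. D p x) ` S n)" if "x \<in> space P" for x n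
    using D_le[OF _ that] by (intro bdd_aboveI[of _ "2 * H x"]) auto
  have D_w: "D p x \<le> w n x" if "p \<in> S n" "x \<in> space P" for p n x
    unfolding w_def using that by (intro cSUP_upper D_bdd)
  have w_nonneg: "0 \<le> w n x" if "x \<in> space P" for n x
    using S_ne[of n] D_w[OF _ that] by (force simp: D_def intro: order.trans)
  have w_le: "w n x \<le> 2 * H x" if "x \<in> space P" for n x
    unfolding w_def using S_ne D_le that by (intro cSUP_least) auto
  \<comment> \<open>The supremum runs over pairs, so the measurability lemma is applied in the
    product space, where \<open>D p x\<close> is continuous in the pair \<open>p\<close>.\<close>
  have w_meas[measurable]: "w n \<in> borel_measurable P" for n
    unfolding w_def
  proof (rule borel_measurable_SUP_continuous)
    fix x assume x: "x \<in> space P"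
    show "continuous_on (S n) (\<lambda>p. D p x)"
      unfolding D_def
      by (intro continuous_intros continuous_on_compose2[OF loss_continuous[OF x]])
         (auto simp: S_def)
  next
    fix p assume "p \<in> S n"
    then have [measurable]: "h (fst p) \<in> borel_measurable P" "h (snd p) \<in> borel_measurable P"
      by (auto simp: S_def intro!: loss_measurable)
    show "D p \<in> borel_measurable P" unfolding D_def by measurable
  qed (use D_bdd S_ne in auto)
  have w_int: "integrable P (w n)" for n
    by (rule Bochner_Integration.integrable_bound[where f = "\<lambda>x. 2 * H x"])
       (use integrable_envelope w_le w_nonneg in \<open>auto intro!: AE_I2 intro: order.trans[OF _ abs_ge_self]\<close>)
  have "(\<lambda>n. \<integral>x. w n x \<partial>P) \<longlonglongrightarrow> (\<integral>x. 0 \<partial>P)"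
  proof (rule integral_dominated_convergence[where w = "\<lambda>x. 2 * H x"])
    show "AE x in P. (\<lambda>n. w n x) \<longlonglongrightarrow> 0"
    proof (intro AE_I2 LIMSEQ_I)
      fix x and r :: real assume x: "x \<in> space P" and r: "r > 0"
      have "uniformly_continuous_on K (\<lambda>a. h a x)"
        using compact_K loss_continuous[OF x] by (rule compact_uniformly_continuous[rotated])
      then obtain d where d: "d > 0" "\<And>a b. a \<in> K \<Longrightarrow> b \<in> K \<Longrightarrow> dist b a < d \<Longrightarrow> dist (h b x) (h a x) < r / 2"
        unfolding uniformly_continuous_on_def using half_gt_zero[OF r] by meson
      obtain N where N: "1 / real (Suc N) < d"
        using nat_approx_posE[OF d(1)] by blast
      \<comment> \<open>A supremum of values below \<open>r / 2\<close> is only weakly bounded by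
        \<open>r / 2\<close>; halving leaves the strict bound by \<open>r\<close>.\<close>
      have "w n x \<le> r / 2" if "n \<ge> N" for n
        unfolding w_def
      proof (rule cSUP_least[OF S_ne])
        fix p assume p: "p \<in> S n"
        have "1 / real (Suc n) \<le> 1 / real (Suc N)"
          using that by (simp add: frac_le)
        then show "D p x \<le> r / 2"
          using p d(2)[of "snd p" "fst p"] N by (auto simp: S_def D_def dist_real_def)
      qed
      then show "\<exists>N. \<forall>n\<ge>N. norm (w n x - 0) < r"
        using r w_nonneg[OF x] by (intro exI[of _ N]) fastforce
    qed
    show "AE x in P. norm (w n x) \<le> 2 * H x" for n
      using w_le w_nonneg by auto
  qed (use integrable_envelope in auto)
  then have "eventually (\<lambda>n. (\<integral>x. w n x \<partial>P) < e) sequentially"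
    using e by (intro order_tendstoD(2)[of _ 0]) auto
  then obtain n where n: "(\<integral>x. w n x \<partial>P) < e"
    by (auto simp: eventually_sequentially)
  show thesis
  proof (rule that[of "1 / real (Suc n)" "w n"])
    fix x a b assume *: "x \<in> space P" "a \<in> K" "b \<in> K" "dist a b < 1 / real (Suc n)"
    show "\<bar>h a x - h b x\<bar> \<le> w n x"
      using D_w[of "(a, b)" n x] * by (auto simp: S_def D_def)
  qed (use n w_int in auto)
qed

section \<open>The expected loss and the minimal empirical loss\<close>

definition expected_loss :: "'a \<Rightarrow> real" where
  "expected_loss a = (\<integral>x. h a x \<partial>P)"

lemma expected_loss_diff_le:
  assumes "a \<in> K" "b \<in> K" "integrable P w" "\<And>x. x \<in> space P \<Longrightarrow> \<bar>h a x - h b x\<bar> \<le> w x"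
  shows "\<bar>expected_loss a - expected_loss b\<bar> \<le> (\<integral>x. w x \<partial>P)"
proof -
  have "\<bar>expected_loss a - expected_loss b\<bar> = \<bar>\<integral>x. h a x - h b x \<partial>P\<bar>"
    using assms by (simp add: expected_loss_def integrable_loss)
  also have "\<dots> \<le> (\<integral>x. \<bar>h a x - h b x\<bar> \<partial>P)"
    by (rule integral_abs_bound)
  also have "\<dots> \<le> (\<integral>x. w x \<partial>P)"
    using assms by (intro integral_mono integrable_abs Bochner_Integration.integrable_diff integrable_loss)
  finally show ?thesis .
qed

text \<open>The integrated modulus of the loss is a modulus for its expectation. Continuity ensures
  that \<open>min_over K expected_loss\<close> is an attained minimum.\<close>

lemma continuous_expected_loss: "continuous_on K expected_loss"
proof (rule continuous_onI)
  fix a and e :: real assume a: "a \<in> K" and e: "0 < e"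
  obtain r w where w: "r > 0" "integrable P w" "(\<integral>x. w x \<partial>P) < e"
    "\<And>x a b. x \<in> space P \<Longrightarrow> a \<in> K \<Longrightarrow> b \<in> K \<Longrightarrow> dist a b < r \<Longrightarrow> \<bar>h a x - h b x\<bar> \<le> w x"
    using modulus_of_continuity[OF e] by metis
  show "\<exists>d>0. \<forall>b\<in>K. dist b a < d \<longrightarrow> dist (expected_loss b) (expected_loss a) \<le> e"
  proof (intro exI conjI ballI impI)
    fix b assume b: "b \<in> K" "dist b a < r"
    show "dist (expected_loss b) (expected_loss a) \<le> e"
      using expected_loss_diff_le[OF b(1) a w(2) w(4)[OF _ b(1) a b(2)]] w(3)
      by (simp add: dist_real_def)
  qed fact
qed

lemma continuous_mean_loss:
  assumes "\<omega> \<in> space M"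
  shows "continuous_on K (\<lambda>a. mean n (h a) \<omega>)"
proof -
  have "continuous_on K (\<lambda>a. \<Sum>i = 1..n. h a (Xs i \<omega>))"
    using assms by (intro continuous_on_sum loss_continuous Xs_in_space) auto
  then show ?thesis
    \<comment> \<open>For \<open>n = 0\<close> the mean is constantly 0; otherwise the divisor is
      nonzero.\<close>
    unfolding mean_def by (cases "n = 0") (auto intro!: continuous_on_divide)
qed

lemma abs_mean_loss_le:
  assumes "a \<in> K" "\<omega> \<in> space M"
  shows "\<bar>mean n (h a) \<omega>\<bar> \<le> mean n H \<omega>"
  using abs_mean_le mean_mono[OF envelope[OF assms(1)] assms(2)] by (rule order.trans)

text \<open>Negation turns the minimum into a supremum of functions that are continuous in the
  parameter and, at each outcome, bounded by the mean of the envelope.\<close>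

lemma borel_measurable_min_mean_loss:
  "(\<lambda>\<omega>. min_over K (\<lambda>a. mean n (h a) \<omega>)) \<in> borel_measurable M"
proof -
  have "(\<lambda>\<omega>. SUP a\<in>K. - mean n (h a) \<omega>) \<in> borel_measurable M"
  proof (rule borel_measurable_SUP_continuous)
    fix \<omega> assume \<omega>: "\<omega> \<in> space M"
    show "continuous_on K (\<lambda>a. - mean n (h a) \<omega>)"
      by (intro continuous_on_minus continuous_mean_loss \<omega>)
    have "- mean n (h a) \<omega> \<le> mean n H \<omega>" if "a \<in> K" for a
      using abs_mean_loss_le[OF that \<omega>, of n] by linarith
    then show "bdd_above ((\<lambda>a. - mean n (h a) \<omega>) ` K)"
      by (intro bdd_aboveI[of _ "mean n H \<omega>"]) auto
  next
    fix a assume "a \<in> K"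
    then show "(\<lambda>\<omega>. - mean n (h a) \<omega>) \<in> borel_measurable M"
      using borel_measurable_integrable[OF integrable_mean[OF integrable_loss]] by simp
  qed (rule K_nonempty)
  then show ?thesis
    by (subst measurable_cong[OF min_over_eq_SUP[OF compact_K K_nonempty continuous_mean_loss]]) auto
qed

lemma integrable_min_mean_loss: "integrable M (\<lambda>\<omega>. min_over K (\<lambda>a. mean n (h a) \<omega>))"
proof (rule Bochner_Integration.integrable_bound[OF integrable_mean[OF integrable_envelope, of n]])
  show "AE \<omega> in M. norm (min_over K (\<lambda>a. mean n (h a) \<omega>)) \<le> norm (mean n H \<omega>)"
  proof (rule AE_I2)
    fix \<omega> assume \<omega>: "\<omega> \<in> space M"
    obtain a where "a \<in> K" "min_over K (\<lambda>a. mean n (h a) \<omega>) = mean n (h a) \<omega>"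
      using min_over_attained[OF compact_K K_nonempty continuous_mean_loss[OF \<omega>, of n]] by blast
    then show "norm (min_over K (\<lambda>a. mean n (h a) \<omega>)) \<le> norm (mean n H \<omega>)"
      using abs_mean_loss_le[OF _ \<omega>, of a n] by simp
  qed
qed (rule borel_measurable_min_mean_loss)

text \<open>Moving each parameter to a point of a finite net bounds the uniform deviation by
  finitely many fluctuations that vanish in L1, plus two expected moduli. The minima then differ by
  no more than that.\<close>

theorem min_mean_loss_tendsto_L1:
  "(\<lambda>n. \<integral>\<omega>. \<bar>min_over K (\<lambda>a. mean n (h a) \<omega>) - min_over K expected_loss\<bar> \<partial>M) \<longlonglongrightarrow> 0"
proof (rule LIMSEQ_I)
  fix e :: real assume e: "e > 0"
  \<comment> \<open>The expected modulus enters twice below, hence \<open>e / 4\<close>; the other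
    half of \<open>e\<close> is left for the fluctuations.\<close>
  obtain r w where w: "r > 0" "integrable P w" "(\<integral>x. w x \<partial>P) < e / 4"
    "\<And>x a b. x \<in> space P \<Longrightarrow> a \<in> K \<Longrightarrow> b \<in> K \<Longrightarrow> dist a b < r \<Longrightarrow> \<bar>h a x - h b x\<bar> \<le> w x"
    using modulus_of_continuity[of "e / 4"] e by (metis zero_less_divide_iff zero_less_numeral)
  obtain F where F: "finite F" "F \<subseteq> K" "K \<subseteq> (\<Union>a\<in>F. ball a r)"
    using compactE_image[OF compact_K, of K "\<lambda>a. ball a r"] w(1) by force
  define Ew where "Ew = (\<integral>x. w x \<partial>P)"
  \<comment> \<open>\<open>B n\<close> collects the random errors: those at the net points and that
    of the averaged modulus.\<close>
  define B where "B n \<omega> = (\<Sum>a\<in>F. \<bar>mean n (h a) \<omega> - expected_loss a\<bar>) + \<bar>mean n w \<omega> - Ew\<bar>" for n \<omega>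
  have B_int: "integrable M (B n)" for n
    unfolding B_def using F(2) w(2)
    by (intro Bochner_Integration.integrable_add Bochner_Integration.integrable_sum integrable_abs
        Bochner_Integration.integrable_diff integrable_mean integrable_loss integrable_const) auto
  have bound: "\<bar>min_over K (\<lambda>a. mean n (h a) \<omega>) - min_over K expected_loss\<bar> \<le> B n \<omega> + 2 * Ew"
    if \<omega>: "\<omega> \<in> space M" for n \<omega>
  proof (rule abs_min_over_diff_le[OF compact_K K_nonempty continuous_mean_loss[OF \<omega>] continuous_expected_loss])
    fix a assume a: "a \<in> K"
    then obtain b where b: "b \<in> F" "dist a b < r"
      using F(3) by (auto simp: dist_commute)
    then have bK: "b \<in> K" using F by auto
    note close = w(4)[OF _ a bK b(2)]
    \<comment> \<open>Replacing \<open>a\<close> by the net point \<open>b\<close> costs \<open>mean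
      n w \<omega> \<le> Ew + \<bar>mean n w \<omega> - Ew\<bar>\<close> in the sample and
      \<open>Ew\<close> in expectation, whence \<open>2 * Ew\<close>.\<close>
    have "\<bar>mean n (h a) \<omega> - mean n (h b) \<omega>\<bar> \<le> mean n w \<omega>"
      unfolding mean_diff[symmetric]
      by (rule order.trans[OF abs_mean_le]) (intro mean_mono close \<omega>)
    moreover have "\<bar>expected_loss a - expected_loss b\<bar> \<le> Ew"
      unfolding Ew_def by (rule expected_loss_diff_le[OF a bK w(2) close])
    moreover have "\<bar>mean n (h b) \<omega> - expected_loss b\<bar> \<le> (\<Sum>a\<in>F. \<bar>mean n (h a) \<omega> - expected_loss a\<bar>)"
      using F(1) b(1) by (intro member_le_sum) auto
    ultimately show "\<bar>mean n (h a) \<omega> - expected_loss a\<bar> \<le> B n \<omega> + 2 * Ew"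
      unfolding B_def by linarith
  qed
  have "(\<lambda>n. (\<Sum>a\<in>F. \<integral>\<omega>. \<bar>mean n (h a) \<omega> - expected_loss a\<bar> \<partial>M) + (\<integral>\<omega>. \<bar>mean n w \<omega> - Ew\<bar> \<partial>M))
      \<longlonglongrightarrow> (\<Sum>a\<in>F. 0) + 0"
    unfolding expected_loss_def Ew_def using F(2) w(2)
    by (intro tendsto_add tendsto_sum mean_tendsto_L1 integrable_loss) auto
  moreover have "(\<Sum>a\<in>F. \<integral>\<omega>. \<bar>mean n (h a) \<omega> - expected_loss a\<bar> \<partial>M) + (\<integral>\<omega>. \<bar>mean n w \<omega> - Ew\<bar> \<partial>M)
      = (\<integral>\<omega>. B n \<omega> \<partial>M)" for n
  proof -
    have int: "integrable M (\<lambda>\<omega>. \<bar>mean n (h a) \<omega> - expected_loss a\<bar>)" if "a \<in> F" for a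
      using that F(2) by (intro integrable_abs Bochner_Integration.integrable_diff integrable_mean integrable_loss integrable_const) auto
    have "integrable M (\<lambda>\<omega>. \<bar>mean n w \<omega> - Ew\<bar>)"
      using w(2) by (intro integrable_abs Bochner_Integration.integrable_diff integrable_mean integrable_const)
    then show ?thesis
      unfolding B_def using int
      by (simp add: Bochner_Integration.integral_add Bochner_Integration.integrable_sum Bochner_Integration.integral_sum)
  qed
  ultimately have "eventually (\<lambda>n. (\<integral>\<omega>. B n \<omega> \<partial>M) < e / 2) sequentially"
    using e by (intro order_tendstoD(2)[of _ 0]) auto
  then obtain N where N: "\<And>n. n \<ge> N \<Longrightarrow> (\<integral>\<omega>. B n \<omega> \<partial>M) < e / 2"
    by (auto simp: eventually_sequentially)
  have "norm ((\<integral>\<omega>. \<bar>min_over K (\<lambda>a. mean n (h a) \<omega>) - min_over K expected_loss\<bar> \<partial>M) - 0) < e"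
    if "n \<ge> N" for n
  proof -
    have "(\<integral>\<omega>. \<bar>min_over K (\<lambda>a. mean n (h a) \<omega>) - min_over K expected_loss\<bar> \<partial>M)
        \<le> (\<integral>\<omega>. B n \<omega> + 2 * Ew \<partial>M)"
      by (intro integral_mono bound integrable_abs Bochner_Integration.integrable_add
          Bochner_Integration.integrable_diff integrable_min_mean_loss B_int integrable_const)
    also have "\<dots> = (\<integral>\<omega>. B n \<omega> \<partial>M) + 2 * Ew"
      using B_int by (simp add: prob_space)
    also have "\<dots> < e"
      using N[OF that] w(3) unfolding Ew_def by linarith
    finally show ?thesis by simp
  qed
  then show "\<exists>N. \<forall>n\<ge>N. norm ((\<integral>\<omega>. \<bar>min_over K (\<lambda>a. mean n (h a) \<omega>) - min_over K expected_loss\<bar> \<partial>M) - 0) < e"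
    by blast
qed

end

section \<open>Consistency of minimizers over a finite set\<close>

lemma argmin_set_eq:
  fixes f :: "'a \<Rightarrow> real"
  shows "argmin_set A f = {a \<in> A. \<forall>b\<in>A. f a \<le> f b}"
  by (auto simp: argmin_set_def is_arg_min_linorder)

lemma argmin_set_nonempty:
  fixes f :: "'a \<Rightarrow> real"
  assumes "finite A" "A \<noteq> {}"
  shows "argmin_set A f \<noteq> {}"
  using ex_is_arg_min_if_finite[OF assms, of f] by (auto simp: argmin_set_def)

text \<open>Only finitely many differences between nonminimal and minimal values occur, and each is
  positive.\<close>

lemma argmin_set_gap:
  fixes L :: "'a \<Rightarrow> real"
  assumes "finite A"
  obtains d where "d > 0"
    "\<And>j k. j \<in> argmin_set A L \<Longrightarrow> k \<in> A - argmin_set A L \<Longrightarrow> L j + d \<le> L k"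
proof -
  define G where "G = (\<lambda>(j, k). L k - L j) ` (argmin_set A L \<times> (A - argmin_set A L))"
  have fin: "finite G"
    using assms by (auto simp: G_def argmin_set_eq)
  have pos: "0 < g" if "g \<in> G" for g
    using that by (force simp: G_def argmin_set_eq not_le)
  show thesis
  \<comment> \<open>The element 1 keeps the set nonempty when every index is a minimizer; any
    positive gap is then valid.\<close>
  proof (rule that[of "Min (insert 1 G)"])
    show "0 < Min (insert 1 G)"
      using fin pos by (subst Min_gr_iff) auto
    fix j k assume "j \<in> argmin_set A L" "k \<in> A - argmin_set A L"
    then have "L k - L j \<in> G" by (force simp: G_def)
    then have "Min (insert 1 G) \<le> L k - L j"
      using fin by (intro Min_le) auto
    then show "L j + Min (insert 1 G) \<le> L k" by simp
  qed
qed

text \<open>For \<open>k\<close> minimizing \<open>V\<close> and \<open>j\<close> minimizing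
  \<open>L\<close>, \<open>L k < V k + d / 2 \<le> V j + d / 2 < L j + d\<close>, which the gap
  excludes unless \<open>k\<close> minimizes \<open>L\<close> too.\<close>

lemma argmin_set_perturbation:
  fixes L V :: "'a \<Rightarrow> real"
  assumes A: "finite A" "A \<noteq> {}"
    and gap: "\<And>j k. j \<in> argmin_set A L \<Longrightarrow> k \<in> A - argmin_set A L \<Longrightarrow> L j + d \<le> L k"
    and close: "\<And>k. k \<in> A \<Longrightarrow> \<bar>V k - L k\<bar> < d / 2"
  shows "argmin_set A V \<subseteq> argmin_set A L"
proof
  fix k assume k: "k \<in> argmin_set A V"
  obtain j where j: "j \<in> argmin_set A L"
    using argmin_set_nonempty[OF A] by blast
  have kj: "k \<in> A" "j \<in> A" "V k \<le> V j"
    using j k by (auto simp: argmin_set_eq)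
  have "L k < L j + d"
    using close[OF kj(1)] close[OF kj(2)] kj(3) by linarith
  then show "k \<in> argmin_set A L"
    using gap[OF j, of k] kj(1) by force
qed

section \<open>Probability that the selected minimizer is correct\<close>

context prob_space
begin

text \<open>The set of minimizers takes finitely many values \<open>S\<close>, each determined by
  finitely many comparisons between measurable functions; hence an arbitrary predicate
  \<open>Q\<close> defines an event.\<close>

lemma sets_argmin:
  fixes V :: "'k \<Rightarrow> 'a \<Rightarrow> real"
  assumes A: "finite A" and V: "\<And>k. k \<in> A \<Longrightarrow> V k \<in> borel_measurable M"
  shows "{\<omega> \<in> space M. Q (argmin_set A (\<lambda>k. V k \<omega>))} \<in> sets M"
proof -
  have "{\<omega> \<in> space M. \<forall>k\<in>A. (k \<in> S) = (\<forall>j\<in>A. V k \<omega> \<le> V j \<omega>)} \<in> sets M" for S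
  proof (intro sets.sets_Collect_finite_All A)
    fix k assume k: "k \<in> A"
    have "{\<omega> \<in> space M. \<forall>j\<in>A. V k \<omega> \<le> V j \<omega>} \<in> sets M"
      using A V k by (intro sets.sets_Collect_finite_All borel_measurable_le)
    then show "{\<omega> \<in> space M. (k \<in> S) = (\<forall>j\<in>A. V k \<omega> \<le> V j \<omega>)} \<in> sets M"
      by (cases "k \<in> S") (auto dest: sets.sets_Collect_neg)
  qed
  then have "(\<Union>S\<in>{S \<in> Pow A. Q S}. {\<omega> \<in> space M. \<forall>k\<in>A. (k \<in> S) = (\<forall>j\<in>A. V k \<omega> \<le> V j \<omega>)}) \<in> sets M"
    using A by (intro sets.finite_UN) auto
  also have "(\<Union>S\<in>{S \<in> Pow A. Q S}. {\<omega> \<in> space M. \<forall>k\<in>A. (k \<in> S) = (\<forall>j\<in>A. V k \<omega> \<le> V j \<omega>)})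
      = {\<omega> \<in> space M. Q (argmin_set A (\<lambda>k. V k \<omega>))}" (is "?L = ?R")
  proof (intro set_eqI)
    fix \<omega>
    have "(\<forall>k\<in>A. (k \<in> S) = (\<forall>j\<in>A. V k \<omega> \<le> V j \<omega>)) \<longleftrightarrow> S = argmin_set A (\<lambda>k. V k \<omega>)"
      if "S \<subseteq> A" for S
      using that unfolding argmin_set_eq by blast
    moreover have "argmin_set A (\<lambda>k. V k \<omega>) \<subseteq> A"
      by (auto simp: argmin_set_eq)
    ultimately show "\<omega> \<in> ?L \<longleftrightarrow> \<omega> \<in> ?R" by auto
  qed
  finally show ?thesis .
qed

text \<open>A wrong selection forces some \<open>V n k\<close> to deviate from \<open>L k\<close> by
  at least half the gap. A union bound and Markov's inequality reduce this to L1 convergence for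
  each \<open>k\<close> separately.\<close>

theorem argmin_consistent:
  fixes V :: "nat \<Rightarrow> 'k::linorder \<Rightarrow> 'a \<Rightarrow> real"
  assumes A: "finite A" "A \<noteq> {}"
    and V: "\<And>n k. k \<in> A \<Longrightarrow> integrable M (V n k)"
    and lim: "\<And>k. k \<in> A \<Longrightarrow> (\<lambda>n. \<integral>\<omega>. \<bar>V n k \<omega> - L k\<bar> \<partial>M) \<longlonglongrightarrow> 0"
  shows "(\<lambda>n. prob {\<omega> \<in> space M. Min (argmin_set A (\<lambda>k. V n k \<omega>)) \<in> argmin_set A L}) \<longlonglongrightarrow> 1"
proof -
  obtain d where d: "d > 0"
    "\<And>j k. j \<in> argmin_set A L \<Longrightarrow> k \<in> A - argmin_set A L \<Longrightarrow> L j + d \<le> L k"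
    using argmin_set_gap[OF A(1), of L] by metis
  define E where "E n = {\<omega> \<in> space M. Min (argmin_set A (\<lambda>k. V n k \<omega>)) \<in> argmin_set A L}" for n
  \<comment> \<open>The inequality is weak, so that outside all \<open>F n k\<close> the strict
    closeness asked for by \<open>argmin_set_perturbation\<close> holds.\<close>
  define F where "F n k = {\<omega> \<in> space M. d / 2 \<le> \<bar>V n k \<omega> - L k\<bar>}" for n k
  have V_meas: "V n k \<in> borel_measurable M" if "k \<in> A" for n k
    using V[OF that] by auto
  have E_sets: "E n \<in> sets M" for n
    unfolding E_def by (rule sets_argmin[OF A(1) V_meas])
  have F_sets: "F n k \<in> sets M" if "k \<in> A" for n k
    using V_meas[OF that, of n] unfolding F_def by measurable
  have lower: "1 - (\<Sum>k\<in>A. (\<integral>\<omega>. \<bar>V n k \<omega> - L k\<bar> \<partial>M) / (d / 2)) \<le> prob (E n)" for n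
  proof -
    have "space M - E n \<subseteq> (\<Union>k\<in>A. F n k)"
    proof (rule subsetI, rule ccontr)
      fix \<omega> assume \<omega>: "\<omega> \<in> space M - E n" "\<omega> \<notin> (\<Union>k\<in>A. F n k)"
      have "argmin_set A (\<lambda>k. V n k \<omega>) \<subseteq> argmin_set A L"
        using A d(2)
      proof (rule argmin_set_perturbation)
        show "\<bar>V n k \<omega> - L k\<bar> < d / 2" if "k \<in> A" for k
          using \<omega> that by (auto simp: F_def not_le)
      qed
      \<comment> \<open>The set of minimizers is finite and nonempty, so its \<open>Min\<close> is a
        member.\<close>
      moreover have "Min (argmin_set A (\<lambda>k. V n k \<omega>)) \<in> argmin_set A (\<lambda>k. V n k \<omega>)"
        using A(1) by (intro Min_in argmin_set_nonempty[OF A]) (auto simp: argmin_set_eq)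
      ultimately show False using \<omega>(1) by (auto simp: E_def)
    qed
    then have "prob (space M - E n) \<le> prob (\<Union>k\<in>A. F n k)"
      using F_sets A(1) by (intro finite_measure_mono sets.finite_UN) auto
    also have "\<dots> \<le> (\<Sum>k\<in>A. prob (F n k))"
      using F_sets A(1) by (intro finite_measure_subadditive_finite) auto
    also have "\<dots> \<le> (\<Sum>k\<in>A. (\<integral>\<omega>. \<bar>V n k \<omega> - L k\<bar> \<partial>M) / (d / 2))"
      unfolding F_def using V d(1) by (intro sum_mono integral_Markov_inequality_measure[where A = "{}"]) auto
    finally show ?thesis
      using prob_compl[OF E_sets[of n]] by linarith
  qed
  have "(\<lambda>n. 1 - (\<Sum>k\<in>A. (\<integral>\<omega>. \<bar>V n k \<omega> - L k\<bar> \<partial>M) / (d / 2))) \<longlonglongrightarrow> 1 - (\<Sum>k\<in>A. 0 / (d / 2))"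
    using d(1) by (intro tendsto_diff tendsto_const tendsto_sum tendsto_divide lim) auto
  then have "(\<lambda>n. prob (E n)) \<longlonglongrightarrow> 1"
    by (intro tendsto_sandwich[OF always_eventually[OF allI[OF lower]] _ _ tendsto_const]) auto
  then show ?thesis unfolding E_def .
qed

end

section \<open>Mixture densities\<close>

text \<open>\<open>max_over\<close> is a \<open>GREATEST\<close>, so it bounds the values only once
  compactness and continuity show that a maximum is attained.\<close>

lemma le_max_over:
  assumes "compact T" "continuous_on T f" "\<theta> \<in> T"
  shows "f \<theta> \<le> max_over T f"
proof -
  obtain t where t: "t \<in> T" "\<forall>s\<in>T. f s \<le> f t"
    using continuous_attains_sup[OF assms(1) _ assms(2)] assms(3) by blast
  then have "max_over T f = f t"
    unfolding max_over_def by (intro Greatest_equality) auto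
  with t assms(3) show ?thesis by auto
qed

section \<open>Topology of the parameter sets and bounds for mixtures\<close>

lemma compact_PiE:
  fixes S :: "'i \<Rightarrow> 'a::topological_space set"
  assumes "\<And>i. i \<in> I \<Longrightarrow> compact (S i)"
  shows "compact (PiE I S)"
proof -
  have "PiE I S = PiE UNIV (\<lambda>i. if i \<in> I then S i else {undefined})"
    by (auto simp: PiE_iff extensional_def split: if_splits)
  \<comment> \<open>extensionality pins the coordinates outside \<open>I\<close> to the point \<open>undefined\<close>, so Tychonoff applies over \<open>UNIV\<close>\<close>
  moreover have "compactin (product_topology (\<lambda>i. euclidean) UNIV)
      (PiE UNIV (\<lambda>i. if i \<in> I then S i else {undefined}))"
    using assms by (subst compactin_PiE) auto
  ultimately show ?thesis by (simp add: euclidean_product_topology)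
qed

lemma continuous_on_coordinate:
  assumes "continuous_on A f"
  shows "continuous_on A (\<lambda>x. f x i)"
  using continuous_on_compose2[OF continuous_on_product_coordinates assms] by simp

text \<open>The admissible weights are the points of a compact cube lying on a closed hyperplane;
  the component parameters form a product of copies of \<open>T\<close>.\<close>

lemma compact_mixture_params:
  fixes T :: "'p::topological_space set"
  assumes "compact T"
  shows "compact (mixture_params T k)"
proof -
  have "closed {p :: nat \<Rightarrow> real. (\<Sum>z = 1..k. p z) = 1}"
    by (intro closed_Collect_eq continuous_on_sum continuous_on_product_coordinates continuous_on_const)
  then have "compact (({1..k} \<rightarrow>\<^sub>E {0..1::real}) \<inter> {p. (\<Sum>z = 1..k. p z) = 1})"
    by (intro compact_Int_closed compact_PiE) auto
  moreover have "({1..k} \<rightarrow>\<^sub>E {0..1::real}) \<inter> {p. (\<Sum>z = 1..k. p z) = 1}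
      = {p \<in> {1..k} \<rightarrow>\<^sub>E {0..1}. (\<Sum>z = 1..k. p z) = 1}" by auto
  ultimately show ?thesis
    unfolding mixture_params_def using assms by (intro compact_Times compact_PiE) auto
qed

lemma mixture_params_nonempty:
  assumes "T \<noteq> {}" "k \<ge> 1"
  shows "mixture_params T k \<noteq> {}"
proof -
  obtain t where "t \<in> T" using assms by blast
  \<comment> \<open>All weight sits on component 1, which exists as \<open>k \<ge> 1\<close>, and
    every component has the same parameter.\<close>
  then have "((\<lambda>z\<in>{1..k}. if z = 1 then 1 else 0), (\<lambda>z\<in>{1..k}. t)) \<in> mixture_params T k"
    using assms(2) by (auto simp: mixture_params_def)
  then show ?thesis by blast
qed

lemma continuous_mixture_density:
  assumes "continuous_on T (\<phi> x)"
  shows "continuous_on (mixture_params T k) (mixture_density \<phi> k x)"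
  unfolding mixture_density_def
  by (intro continuous_on_sum continuous_on_mult continuous_on_compose2[OF assms]
      continuous_on_coordinate[OF continuous_on_fst] continuous_on_coordinate[OF continuous_on_snd]
      continuous_on_id)
     (auto simp: mixture_params_def PiE_iff)

text \<open>A mixture is a convex combination of its component densities.\<close>

lemma mixture_density_bounds:
  assumes \<psi>: "\<psi> \<in> mixture_params T k"
    and bounds: "\<And>\<theta>. \<theta> \<in> T \<Longrightarrow> l \<le> \<phi> x \<theta> \<and> \<phi> x \<theta> \<le> u"
  shows "l \<le> mixture_density \<phi> k x \<psi>" "mixture_density \<phi> k x \<psi> \<le> u"
proof -
  have p: "(\<Sum>z = 1..k. fst \<psi> z) = 1" "\<And>z. z \<in> {1..k} \<Longrightarrow> 0 \<le> fst \<psi> z \<and> snd \<psi> z \<in> T"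
    using \<psi> by (auto simp: mixture_params_def PiE_iff)
  have const: "(\<Sum>z = 1..k. fst \<psi> z * c) = c" for c
    using p(1) by (simp add: sum_distrib_right[symmetric])
  have "(\<Sum>z = 1..k. fst \<psi> z * l) \<le> mixture_density \<phi> k x \<psi>"
    "mixture_density \<phi> k x \<psi> \<le> (\<Sum>z = 1..k. fst \<psi> z * u)"
    unfolding mixture_density_def using p(2) bounds by (auto intro!: sum_mono mult_left_mono)
  then show "l \<le> mixture_density \<phi> k x \<psi>" "mixture_density \<phi> k x \<psi> \<le> u"
    unfolding const .
qed

text \<open>In the form \<open>exp (- g) \<le> \<phi> x \<theta>\<close> and
  \<open>\<phi> x \<theta> \<le> exp g\<close> the bound passes to convex combinations, so an
  envelope for the components serves mixtures of every order.\<close>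

lemma abs_ln_mixture_density_le:
  assumes \<psi>: "\<psi> \<in> mixture_params T k"
    and pos: "\<And>\<theta>. \<theta> \<in> T \<Longrightarrow> \<phi> x \<theta> > 0"
    and bound: "\<And>\<theta>. \<theta> \<in> T \<Longrightarrow> \<bar>ln (\<phi> x \<theta>)\<bar> \<le> g"
  shows "mixture_density \<phi> k x \<psi> > 0" "\<bar>ln (mixture_density \<phi> k x \<psi>)\<bar> \<le> g"
proof -
  have "exp (- g) \<le> \<phi> x \<theta> \<and> \<phi> x \<theta> \<le> exp g" if "\<theta> \<in> T" for \<theta>
  proof -
    have "exp (- g) \<le> exp (ln (\<phi> x \<theta>))" "exp (ln (\<phi> x \<theta>)) \<le> exp g"
      using bound[OF that] unfolding exp_le_cancel_iff by linarith+
    then show ?thesis using pos[OF that] by simp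
  qed
  note b = mixture_density_bounds[OF \<psi>, of "exp (- g)" \<phi> x "exp g", OF this]
  show pos: "mixture_density \<phi> k x \<psi> > 0"
    using b(1) exp_gt_zero[of "- g"] by linarith
  have "ln (exp (- g)) \<le> ln (mixture_density \<phi> k x \<psi>)" "ln (mixture_density \<phi> k x \<psi>) \<le> ln (exp g)"
    using b pos by (subst ln_le_cancel_iff; simp)+
  then show "\<bar>ln (mixture_density \<phi> k x \<psi>)\<bar> \<le> g" by simp
qed

section \<open>Consistency of order selection for mixtures\<close>

theorem proposition13:
  fixes M :: "'w measure"
    and \<mm> :: "'x::topological_space measure"
    and X :: "'w \<Rightarrow> 'x"
    and Xs :: "nat \<Rightarrow> 'w \<Rightarrow> 'x"
    and f0 :: "'x \<Rightarrow> real"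
    and T :: "(real ^ 'm) set"
    and \<phi> :: "'x \<Rightarrow> real ^ 'm \<Rightarrow> real"
    and G1 :: "'x \<Rightarrow> real"
    and kbar :: nat
    and pen :: "nat \<Rightarrow> nat \<Rightarrow> real"
  assumes prob: "prob_space M"
    and sets_m: "sets \<mm> = sets borel"
    and kbar: "kbar \<ge> 1"
    and T_nonempty: "T \<noteq> {}"
    and \<phi>_density: "\<And>\<theta>. \<theta> \<in> T \<Longrightarrow> (\<integral>x. \<phi> x \<theta> \<partial>\<mm>) = 1"
    and A1_density: "distributed M \<mm> X (\<lambda>x. ennreal (f0 x))"
    and A1_pos: "\<And>x. f0 x > 0"
    and A1_indep: "prob_space.indep_vars M (\<lambda>_. borel) Xs {1..}"
    and A1_ident: "\<And>i. i \<ge> 1 \<Longrightarrow> distr M borel (Xs i) = distr M borel X"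
    and A2_pos: "\<And>x \<theta>. \<theta> \<in> T \<Longrightarrow> \<phi> x \<theta> > 0"
    and A2_compact: "compact T"
    and A3_cont: "\<And>x. continuous_on T (\<phi> x)"
    and A3_meas: "\<And>\<theta>. \<theta> \<in> T \<Longrightarrow> (\<lambda>x. \<phi> x \<theta>) \<in> borel_measurable borel"
    and A4_integrable: "integrable (distr M borel X) G1"
    and A4_bound: "\<And>x. max_over T (\<lambda>\<theta>. \<bar>ln (\<phi> x \<theta>)\<bar>) < G1 x"
    and B1: "\<And>k. k \<in> {1..kbar} \<Longrightarrow> (\<lambda>n. pen k n) \<longlonglongrightarrow> 0"
  shows "(\<lambda>n. measure M {\<omega> \<in> space M.
            order_estimate T \<phi> kbar pen n (\<lambda>i. Xs i \<omega>) \<in> optimal_orders M X T \<phi> kbar})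
         \<longlonglongrightarrow> 1"
proof -
  interpret prob_space M by (rule prob)
  have X[measurable]: "X \<in> borel_measurable M"
    using distributed_measurable[OF A1_density] measurable_cong_sets[OF refl sets_m, of M] by simp
  define P where "P = distr M borel X"
  have sets_P[measurable_cong]: "sets P = sets borel"
    by (simp add: P_def)
  interpret iid_sample M P Xs
  proof
    \<comment> \<open>\<open>P\<close> and \<open>borel\<close> have the same measurable sets, so
      independence transfers along the identity map.\<close>
    show "indep_vars (\<lambda>_. P) Xs {1..}"
      using indep_vars_compose2[OF A1_indep, of "\<lambda>_ x. x" "\<lambda>_. P"]
      by (simp add: measurable_ident_sets sets_P)
    show "distr M P (Xs i) = P" if "i \<ge> 1" for i
      using A1_ident[OF that] distr_cong[OF refl sets_P, of M "Xs i" "Xs i"] by (simp add: P_def)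
  qed
  \<comment> \<open>The loss of one observation is its negative log-likelihood: its average is the
    empirical risk, its expectation the risk.\<close>
  define h where "h k \<psi> x = - ln (mixture_density \<phi> k x \<psi>)" for k \<psi> x
  have ln_bound: "\<bar>ln (\<phi> x \<theta>)\<bar> \<le> G1 x" if "\<theta> \<in> T" for x \<theta>
  proof -
    \<comment> \<open>Continuity makes the maximum in A4 attained, hence a bound at every
      \<open>\<theta>\<close>.\<close>
    have "continuous_on T (\<lambda>\<theta>. \<bar>ln (\<phi> x \<theta>)\<bar>)"
      using A2_pos[of _ x] by (intro continuous_on_rabs continuous_on_ln A3_cont) force
    then show ?thesis
      using le_max_over[OF A2_compact _ that, of "\<lambda>\<theta>. \<bar>ln (\<phi> x \<theta>)\<bar>"] A4_bound[of x] by simp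
  qed
  have dens: "mixture_density \<phi> k x \<psi> > 0" "\<bar>ln (mixture_density \<phi> k x \<psi>)\<bar> \<le> G1 x"
    if "\<psi> \<in> mixture_params T k" for k x \<psi>
    using abs_ln_mixture_density_le[of \<psi> T k \<phi> x "G1 x"] that A2_pos ln_bound by auto
  \<comment> \<open>Every order is an instance of the uniform law, with the same envelope
    \<open>G1\<close>.\<close>
  have loss: "compact_loss M P Xs (mixture_params T k) (h k) G1" if k: "k \<in> {1..kbar}" for k
  proof
    show "compact (mixture_params T k)" "mixture_params T k \<noteq> {}"
      using compact_mixture_params[OF A2_compact] mixture_params_nonempty[OF T_nonempty] k by auto
    show "continuous_on (mixture_params T k) (\<lambda>\<psi>. h k \<psi> x)" for x
      unfolding h_def using dens(1)[of _ k x]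
      by (intro continuous_on_minus continuous_on_ln continuous_mixture_density A3_cont) force
    show "h k \<psi> \<in> borel_measurable P" if "\<psi> \<in> mixture_params T k" for \<psi>
    proof -
      have "(\<lambda>x. fst \<psi> z * \<phi> x (snd \<psi> z)) \<in> borel_measurable P" if "z \<in> {1..k}" for z
        using that \<open>\<psi> \<in> _\<close> A3_meas[of "snd \<psi> z"] unfolding measurable_cong_sets[OF sets_P refl]
        by (auto simp: mixture_params_def PiE_iff)
      then show ?thesis unfolding h_def mixture_density_def by measurable
    qed
    show "integrable P G1" using A4_integrable by (simp add: P_def)
  qed (use dens(2) in \<open>simp add: h_def\<close>)
  have emp: "emp_risk n (\<lambda>i. Xs i \<omega>) \<phi> k = (\<lambda>\<psi>. mean n (h k \<psi>) \<omega>)" for n k \<omega>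
    by (simp add: fun_eq_iff emp_risk_def mean_def h_def sum_negf)
  define V where "V n k \<omega> = min_over (mixture_params T k) (\<lambda>\<psi>. mean n (h k \<psi>) \<omega>) + pen k n" for n k \<omega>
  define L where "L k = min_over (mixture_params T k) (risk M X \<phi> k)" for k
  have L_eq: "L k = min_over (mixture_params T k) (compact_loss.expected_loss P (h k))"
    if k: "k \<in> {1..kbar}" for k
  proof -
    interpret compact_loss M P Xs "mixture_params T k" "h k" G1 by (rule loss[OF k])
    have "risk M X \<phi> k \<psi> = expected_loss \<psi>" if "\<psi> \<in> mixture_params T k" for \<psi>
    proof -
      have "h k \<psi> \<in> borel_measurable borel"
        using loss_measurable[OF that] by (simp add: measurable_cong_sets[OF sets_P refl])
      from integral_distr[OF X this] have "expected_loss \<psi> = (\<integral>\<omega>. h k \<psi> (X \<omega>) \<partial>M)"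
        by (simp add: expected_loss_def P_def[symmetric])
      then show ?thesis by (simp add: risk_def h_def)
    qed
    \<comment> \<open>Risk and expected loss are compared only on the parameter set, where
      \<open>h k \<psi>\<close> is known to be measurable; this is enough because
      \<open>min_over\<close> depends on the image alone.\<close>
    then have "risk M X \<phi> k ` mixture_params T k = expected_loss ` mixture_params T k"
      by (intro image_cong) auto
    then show ?thesis by (simp add: L_def min_over_def)
  qed
  have "(\<lambda>n. prob {\<omega> \<in> space M. Min (argmin_set {1..kbar} (\<lambda>k. V n k \<omega>)) \<in> argmin_set {1..kbar} L}) \<longlonglongrightarrow> 1"
  proof (rule argmin_consistent)
    fix k assume k: "k \<in> {1..kbar}"
    interpret compact_loss M P Xs "mixture_params T k" "h k" G1 by (rule loss[OF k])
    let ?min = "\<lambda>n \<omega>. min_over (mixture_params T k) (\<lambda>\<psi>. mean n (h k \<psi>) \<omega>)"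
    show V_int: "integrable M (V n k)" for n
      unfolding V_def by (intro Bochner_Integration.integrable_add integrable_min_mean_loss integrable_const)
    show "(\<lambda>n. \<integral>\<omega>. \<bar>V n k \<omega> - L k\<bar> \<partial>M) \<longlonglongrightarrow> 0"
    proof (rule tendsto_sandwich[where f = "\<lambda>_. 0"])
      \<comment> \<open>The deterministic penalty increases the L1 distance by at most its absolute
        value, which B1 sends to 0.\<close>
      have "(\<integral>\<omega>. \<bar>V n k \<omega> - L k\<bar> \<partial>M) \<le> (\<integral>\<omega>. \<bar>?min n \<omega> - L k\<bar> + \<bar>pen k n\<bar> \<partial>M)" for n
        by (intro integral_mono integrable_abs Bochner_Integration.integrable_add V_int
            Bochner_Integration.integrable_diff integrable_min_mean_loss integrable_const)
          (auto simp: V_def)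
      also have "(\<integral>\<omega>. \<bar>?min n \<omega> - L k\<bar> + \<bar>pen k n\<bar> \<partial>M) = (\<integral>\<omega>. \<bar>?min n \<omega> - L k\<bar> \<partial>M) + \<bar>pen k n\<bar>" for n
        using integrable_min_mean_loss[of n] by (simp add: prob_space)
      finally show "\<forall>\<^sub>F n in sequentially.
          (\<integral>\<omega>. \<bar>V n k \<omega> - L k\<bar> \<partial>M) \<le> (\<integral>\<omega>. \<bar>?min n \<omega> - L k\<bar> \<partial>M) + \<bar>pen k n\<bar>"
        by (intro always_eventually allI)
      show "(\<lambda>n. (\<integral>\<omega>. \<bar>?min n \<omega> - L k\<bar> \<partial>M) + \<bar>pen k n\<bar>) \<longlonglongrightarrow> 0"
        using tendsto_add[OF min_mean_loss_tendsto_L1 tendsto_rabs_zero[OF B1[OF k]]]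
        by (simp add: L_eq[OF k])
    qed auto
  qed (use kbar in auto)
  then show ?thesis
    by (simp add: order_estimate_def optimal_orders_def emp V_def L_def[abs_def])
qed

end
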